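(* Let $I\subset R=K[x_1,\ldots,x_n]$ be a square-free monomial ideal and let $\mathfrak{q}$ be a prime monomial ideal in $R$. Let $L:=I\cap(\mathfrak{q},x_r)$ be such that $x_r\notin\mathrm{supp}(\mathfrak{q})\cup\mathrm{supp}(I)$ and $\mathrm{Ass}(L)=\mathrm{Ass}(I)\cup\{(\mathfrak{q},x_r)\}$. If $\mathfrak{p}$ is a monomial prime ideal with $\mathfrak{p}=(L^s:x_r^{\theta}v)$ for some $s\ge 2$, $\theta\ge 0$, and monomial $v$ with $x_r\nmid v$, then $\mathfrak{p}\setminus x_r\in\mathrm{Ass}(I^{\theta}(I\cap\mathfrak{q})^{s-\theta})$.
   Context: $R=K[x_1,\ldots,x_n]$ is a polynomial ring over a field $K$, and $x_r$ is one of its variables. For an ideal $J\subset R$, $\mathrm{Ass}(J)=\mathrm{Ass}_R(R/J)$ denotes the set of associated primes of $J$, i.e. the prime ideals of the form $(J:f)$ with $f\in R$. For a monomial ideal $J$ with minimal monomial generating set $\mathcal{G}(J)$, $\mathrm{supp}(J)$ is the set of variables dividing some element of $\mathcal{G}(J)$. A prime monomial ideal (monomial prime ideal) is a prime ideal generated by a set of variables. $(\mathfrak{q},x_r)$ denotes $\mathfrak{q}+x_rR$. For a monomial ideal $J$, the deletion $J\setminus x_r$ is formed by setting $x_r=0$ in each $u\in\mathcal{G}(J)$; thus for a monomial prime $\mathfrak{p}$, $\mathfrak{p}\setminus x_r$ is the ideal generated by the variables in $\mathfrak{p}$ other than $x_r$. The zeroth power of an ideal is $R$.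
   Formalization: The formal statement adds the hypothesis θ ≤ s, since for θ > s the power (I∩q)^{s−θ} in the conclusion has a negative exponent and is undefined. *)

theory Defs
  imports
    "HOL-Library.Poly_Mapping"
    "HOL-Algebra.Ideal_Product"
    "HOL-Decision_Procs.Algebra_Aux"
begin

text \<open>
  The ring \<open>K[x\<^sub>1, \<dots>, x\<^sub>n]\<close> is the type of finitely supported maps from exponent vectors to \<open>'k\<close>,
  with the elements of the finite type \<open>'n\<close> indexing the variables. \<open>cring_class_ops\<close> is this
  type viewed as a ring record with carrier \<open>UNIV\<close>.
\<close>

type_synonym ('n, 'k) mpoly = "('n \<Rightarrow>\<^sub>0 nat) \<Rightarrow>\<^sub>0 'k"

abbreviation PolyRing :: "('n, 'k::field) mpoly ring" where
  "PolyRing \<equiv> cring_class_ops"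

definition Var :: "'n \<Rightarrow> ('n, 'k::field) mpoly" where
  "Var i = Poly_Mapping.single (Poly_Mapping.single i 1) 1"

definition monomials :: "('n, 'k::field) mpoly set" where
  "monomials = range (\<lambda>m. Poly_Mapping.single m 1)"

definition colon :: "('n, 'k::field) mpoly set \<Rightarrow> ('n, 'k) mpoly \<Rightarrow> ('n, 'k) mpoly set" where
  "colon J f = {g. g * f \<in> J}"

definition Ass :: "('n, 'k::field) mpoly set \<Rightarrow> ('n, 'k) mpoly set set" where
  "Ass J = {P. primeideal P PolyRing \<and> (\<exists>f. P = colon J f)}"

abbreviation ideal_power :: "('n, 'k::field) mpoly set \<Rightarrow> nat \<Rightarrow> ('n, 'k) mpoly set" where
  "ideal_power J k \<equiv> J [^]\<^bsub>ideals_set PolyRing\<^esub> k"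

definition monomial_ideal :: "('n, 'k::field) mpoly set \<Rightarrow> bool" where
  "monomial_ideal J \<longleftrightarrow> (\<exists>M \<subseteq> monomials. J = Idl\<^bsub>PolyRing\<^esub> M)"

definition squarefree_monomial_ideal :: "('n, 'k::field) mpoly set \<Rightarrow> bool" where
  "squarefree_monomial_ideal J \<longleftrightarrow>
     (\<exists>M \<subseteq> monomials. (\<forall>u\<in>M. \<forall>i. \<not> Var i ^ 2 dvd u) \<and> J = Idl\<^bsub>PolyRing\<^esub> M)"

definition monomial_prime_ideal :: "('n, 'k::field) mpoly set \<Rightarrow> bool" where
  "monomial_prime_ideal P \<longleftrightarrow>
     primeideal P PolyRing \<and> (\<exists>A. P = Idl\<^bsub>PolyRing\<^esub> (Var ` A))"

definition min_monomial_gens ::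
  "('n, 'k::field) mpoly set \<Rightarrow> ('n, 'k) mpoly set \<Rightarrow> bool" where
  "min_monomial_gens J G \<longleftrightarrow>
     G \<subseteq> monomials \<and> Idl\<^bsub>PolyRing\<^esub> G = J \<and> (\<forall>H. H \<subset> G \<longrightarrow> Idl\<^bsub>PolyRing\<^esub> H \<noteq> J)"

text \<open>
  The definite description is only meaningful for monomial ideals; existence and uniqueness are
  proved in \<open>min_monomial_gens_ex1\<close> below.
\<close>

definition mingens :: "('n, 'k::field) mpoly set \<Rightarrow> ('n, 'k) mpoly set" where
  "mingens J = (THE G. min_monomial_gens J G)"

definition supp :: "('n, 'k::field) mpoly set \<Rightarrow> ('n, 'k) mpoly set" where
  "supp J = {Var i | i. \<exists>u\<in>mingens J. Var i dvd u}"

text \<open>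
  Setting \<open>x\<^sub>r = 0\<close> in a monomial gives \<open>0\<close> if \<open>x\<^sub>r\<close> divides it and leaves it unchanged otherwise.
\<close>

definition deletion :: "'n \<Rightarrow> ('n, 'k::field) mpoly set \<Rightarrow> ('n, 'k) mpoly set" where
  "deletion r J = Idl\<^bsub>PolyRing\<^esub> ((\<lambda>u. if Var r dvd u then 0 else u) ` mingens J)"

lemma ring_PolyRing: "ring (PolyRing :: ('n, 'k::field) mpoly ring)"
  by (rule cring_class.ring_axioms)

lemma carrier_PolyRing: "carrier (PolyRing :: ('n, 'k::field) mpoly ring) = UNIV"
  by (simp add: cring_class_ops_def)

lemma genideal_self_PolyRing: "M \<subseteq> Idl\<^bsub>PolyRing\<^esub> (M :: ('n, 'k::field) mpoly set)"
  by (rule ring.genideal_self[OF ring_PolyRing]) (simp add: carrier_PolyRing)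

lemmas genideal_minimal_PolyRing = ring.genideal_minimal[OF ring_PolyRing]

lemma genideal_is_ideal: "ideal (Idl\<^bsub>PolyRing\<^esub> M) (PolyRing :: ('n, 'k::field) mpoly ring)"
  by (rule ring.genideal_ideal[OF ring_PolyRing]) (simp add: carrier_PolyRing)

lemma ideal_mult_left:
  fixes a b :: "('n, 'k::field) mpoly"
  assumes "ideal J PolyRing" "a \<in> J"
  shows "b * a \<in> J"
  using ideal.I_l_closed[OF assms, of b] by (simp add: cring_class_ops_def)

lemma single_in_genideal_iff:
  fixes M :: "('n, 'k::field) mpoly set"
  assumes M: "M \<subseteq> monomials"
  shows "Poly_Mapping.single m 1 \<in> Idl\<^bsub>PolyRing\<^esub> M \<longleftrightarrow>
    (\<exists>u w. Poly_Mapping.single u 1 \<in> M \<and> m = u + w)"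
proof
  define D where "D = {m. \<exists>u w. Poly_Mapping.single u (1::'k) \<in> M \<and> m = u + w}"
  define T where "T = {f :: ('n, 'k) mpoly. Poly_Mapping.keys f \<subseteq> D}"
  have D_add: "a + m \<in> D" if "m \<in> D" for a m
    using that unfolding D_def by (auto simp: ac_simps)
  have T_mult: "a * f \<in> T" if "f \<in> T" for a f
    using that keys_mult[of a f] D_add unfolding T_def by blast
  have T_mult_right: "f * a \<in> T" if "f \<in> T" for a f
    using T_mult[OF that] by (simp add: mult.commute)
  have "ideal T PolyRing"
  proof (rule idealI)
    show "ring (PolyRing :: ('n, 'k) mpoly ring)"
      by (rule ring_PolyRing)
    show "subgroup T (add_monoid (PolyRing :: ('n, 'k) mpoly ring))"
    proof (rule group.subgroupI)
      show "Group.group (add_monoid (PolyRing :: ('n, 'k) mpoly ring))"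
        by (rule abelian_group.a_group[OF ring.is_abelian_group[OF ring_PolyRing]])
      show "T \<noteq> {}" unfolding T_def by (auto intro: exI[of _ 0])
      show "inv\<^bsub>add_monoid PolyRing\<^esub> a \<in> T" if "a \<in> T" for a
      proof -
        have "inv\<^bsub>add_monoid PolyRing\<^esub> a = - a"
          using uminus_class[of a] by (simp add: a_inv_def)
        then show ?thesis using that by (simp add: T_def)
      qed
      show "a \<otimes>\<^bsub>add_monoid PolyRing\<^esub> b \<in> T" if "a \<in> T" "b \<in> T" for a b
        using that Poly_Mapping.keys_add[of a b] by (auto simp: T_def cring_class_ops_def)
    qed (auto simp: cring_class_ops_def)
  qed (auto simp: cring_class_ops_def T_mult T_mult_right)
  moreover have "M \<subseteq> T"
  proof
    fix f assume "f \<in> M"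
    with M obtain u where f: "f = Poly_Mapping.single u 1" by (auto simp: monomials_def)
    moreover have "u = u + 0" by simp
    ultimately have "u \<in> D" using \<open>f \<in> M\<close> unfolding D_def by blast
    with f show "f \<in> T" by (simp add: T_def)
  qed
  ultimately have "Idl\<^bsub>PolyRing\<^esub> M \<subseteq> T"
    by (rule genideal_minimal_PolyRing)
  moreover assume "Poly_Mapping.single m 1 \<in> Idl\<^bsub>PolyRing\<^esub> M"
  ultimately have "Poly_Mapping.single m 1 \<in> T" by (rule subsetD)
  then have "m \<in> D" by (simp add: T_def)
  then show "\<exists>u w. Poly_Mapping.single u 1 \<in> M \<and> m = u + w"
    unfolding D_def by (rule CollectD)
next
  assume "\<exists>u w. Poly_Mapping.single u 1 \<in> M \<and> m = u + w"
  then obtain u w where uw: "Poly_Mapping.single u 1 \<in> M" "m = u + w"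
    by blast
  have "Poly_Mapping.single u 1 \<in> Idl\<^bsub>PolyRing\<^esub> M"
    by (rule subsetD[OF genideal_self_PolyRing uw(1)])
  from ideal_mult_left[OF genideal_is_ideal this, of "Poly_Mapping.single w 1"]
  show "Poly_Mapping.single m 1 \<in> Idl\<^bsub>PolyRing\<^esub> M"
    by (simp add: mult_single uw(2) add.commute[of w u])
qed

lemma min_monomial_gens_eq:
  fixes J :: "('n::finite, 'k::field) mpoly set"
  assumes J: "monomial_ideal J"
  defines "H \<equiv> {Poly_Mapping.single m 1 | m. Poly_Mapping.single m (1::'k) \<in> J \<and>
                 (\<forall>u w. Poly_Mapping.single u (1::'k) \<in> J \<and> m = u + w \<longrightarrow> w = 0)}"
  shows "min_monomial_gens J G \<longleftrightarrow> G = H"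
proof -
  have H: "H \<subseteq> monomials" and HJ: "H \<subseteq> J" by (auto simp: H_def monomials_def)
  obtain M where M: "M \<subseteq> monomials" "J = Idl\<^bsub>PolyRing\<^esub> M"
    using J by (auto simp: monomial_ideal_def)
  have sub: "H \<subseteq> G" if G: "G \<subseteq> monomials" "Idl\<^bsub>PolyRing\<^esub> G = J" for G
  proof
    fix f assume "f \<in> H"
    then obtain m where m: "f = Poly_Mapping.single m 1" "Poly_Mapping.single m (1::'k) \<in> J"
      "\<And>u w. Poly_Mapping.single u (1::'k) \<in> J \<Longrightarrow> m = u + w \<Longrightarrow> w = 0"
      by (auto simp: H_def)
    obtain u w where uw: "Poly_Mapping.single u (1::'k) \<in> G" "m = u + w"
      using m(2) unfolding G(2)[symmetric] using single_in_genideal_iff[OF G(1)] by blast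
    have "Poly_Mapping.single u (1::'k) \<in> J"
      using genideal_self_PolyRing[of G] uw(1) G(2) by auto
    with m(3) uw(2) have "w = 0" by blast
    with uw m(1) show "f \<in> G" by simp
  qed
  have below: "Poly_Mapping.single m (1::'k) \<in> J \<Longrightarrow>
      \<exists>u w. Poly_Mapping.single u (1::'k) \<in> H \<and> m = u + w" for m
  proof (induction "\<Sum>i\<in>UNIV. Poly_Mapping.lookup m i" arbitrary: m rule: less_induct)
    case less
    show ?case
    proof (cases "Poly_Mapping.single m (1::'k) \<in> H")
      case True
      then show ?thesis by (intro exI[of _ m] exI[of _ 0]) simp
    next
      case False
      then obtain u w where uw: "Poly_Mapping.single u (1::'k) \<in> J" "m = u + w" "w \<noteq> 0"
        using less.prems by (auto simp: H_def)
      obtain i where "Poly_Mapping.lookup w i \<noteq> 0"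
        using uw(3) by (metis lookup_zero poly_mapping_eqI)
      then have "0 < (\<Sum>i\<in>UNIV. Poly_Mapping.lookup w i)"
        by (metis UNIV_I finite_UNIV gr0I sum_eq_0_iff)
      then have "(\<Sum>i\<in>UNIV. Poly_Mapping.lookup u i) < (\<Sum>i\<in>UNIV. Poly_Mapping.lookup m i)"
        by (simp add: uw(2) lookup_add sum.distrib)
      from less.hyps[OF this uw(1)] show ?thesis
        by (metis uw(2) add.assoc)
    qed
  qed
  have "M \<subseteq> Idl\<^bsub>PolyRing\<^esub> H"
  proof
    fix f assume "f \<in> M"
    then obtain m where m: "f = Poly_Mapping.single m 1" using M(1) by (auto simp: monomials_def)
    moreover have "f \<in> J" using genideal_self_PolyRing[of M] M(2) \<open>f \<in> M\<close> by auto
    ultimately show "f \<in> Idl\<^bsub>PolyRing\<^esub> H"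
      using below single_in_genideal_iff[OF H] by simp
  qed
  then have "J \<subseteq> Idl\<^bsub>PolyRing\<^esub> H"
    unfolding M(2) by (intro genideal_minimal_PolyRing genideal_is_ideal)
  moreover have "Idl\<^bsub>PolyRing\<^esub> H \<subseteq> J"
    using HJ unfolding M(2) by (intro genideal_minimal_PolyRing genideal_is_ideal)
  ultimately have gen: "Idl\<^bsub>PolyRing\<^esub> H = J" by (rule subset_antisym[rotated])
  show ?thesis
  proof
    assume "min_monomial_gens J G"
    then have G: "G \<subseteq> monomials" "Idl\<^bsub>PolyRing\<^esub> G = J" "\<not> H \<subset> G"
      using gen by (auto simp only: min_monomial_gens_def)
    then show "G = H" using sub[OF G(1,2)] by (simp add: psubset_eq)
  next
    assume "G = H"
    have "\<not> H' \<subset> H" if "Idl\<^bsub>PolyRing\<^esub> H' = J" for H'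
      using sub[OF _ that] H by (meson order.trans psubset_imp_subset subset_not_subset_eq)
    then show "min_monomial_gens J G"
      unfolding min_monomial_gens_def \<open>G = H\<close> using H gen by (simp only: simp_thms) metis
  qed
qed

lemma min_monomial_gens_ex1:
  fixes J :: "('n::finite, 'k::field) mpoly set"
  assumes "monomial_ideal J"
  shows "\<exists>!G. min_monomial_gens J G"
  unfolding min_monomial_gens_eq[OF assms] by (rule ex1_eq)

end

theory Submission
  imports Defs
begin

text \<open>A monomial ideal is determined by the exponents of its monomials, so the argument runs
  on upward closed sets of exponent vectors, and \<open>mon_span\<close> translates back to ideals.
  Write Q for the intersection of I and q. Since x_r occurs in the minimal generators of neither I
  nor q, L = Q + x_r I, and hence L^s is the sum over j of x_r^j I^j Q^(s-j). As Q lies in I, the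
  ideals I^j Q^(s-j) increase with j, so a monomial of x_r-degree exactly \<theta> \<le> s lies in
  L^s iff it lies in I^\<theta> Q^(s-\<theta>) (\<open>sumpow_slice_iff\<close>).

  For a monomial m without x_r, the product m x_r^\<theta> v has x_r-degree exactly \<theta>; so m
  lies in p iff m v lies in I^\<theta> Q^(s-\<theta>). Membership in the deletion of p is decided
  after erasing x_r (\<open>deletion_mon_span\<close>), and I^\<theta> Q^(s-\<theta>) does not see
  x_r either, so the deletion is the colon of this ideal by v. It is generated by variables, hence
  prime (\<open>primeideal_genideal_Var\<close>), and v is the witness that it is
  associated.\<close>

section \<open>Arithmetic of exponent sets\<close>

definition upward_closed :: "('n \<Rightarrow>\<^sub>0 nat) set \<Rightarrow> bool" where
  "upward_closed D \<longleftrightarrow> (\<forall>m\<in>D. \<forall>w. m + w \<in> D)"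

text \<open>A linear span in general; it is an ideal when \<open>D\<close> is upward closed, and
  every monomial ideal arises in this way.\<close>

definition mon_span :: "('n \<Rightarrow>\<^sub>0 nat) set \<Rightarrow> ('n, 'k::field) mpoly set" where
  "mon_span D = {f. Poly_Mapping.keys f \<subseteq> D}"

definition sumset :: "('n \<Rightarrow>\<^sub>0 nat) set \<Rightarrow> ('n \<Rightarrow>\<^sub>0 nat) set \<Rightarrow> ('n \<Rightarrow>\<^sub>0 nat) set" where
  "sumset D E = {a + b | a b. a \<in> D \<and> b \<in> E}"

text \<open>The \<open>0\<close>-fold sumset is everything, matching the convention that the zeroth power of an ideal is the ring.\<close>

primrec sumpow :: "('n \<Rightarrow>\<^sub>0 nat) set \<Rightarrow> nat \<Rightarrow> ('n \<Rightarrow>\<^sub>0 nat) set" where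
  "sumpow D 0 = UNIV"
| "sumpow D (Suc n) = sumset (sumpow D n) D"

text \<open>On monomials this is the substitution x_r = 1, in contrast to the x_r = 0 of
  \<open>deletion\<close>.\<close>

definition erase :: "'n \<Rightarrow> ('n \<Rightarrow>\<^sub>0 nat) \<Rightarrow> ('n \<Rightarrow>\<^sub>0 nat)" where
  "erase r m = Poly_Mapping.update r 0 m"

text \<open>For upward closed \<open>D\<close> this says that the ideal is generated by monomials
  not involving x_r.\<close>

definition var_free :: "'n \<Rightarrow> ('n \<Rightarrow>\<^sub>0 nat) set \<Rightarrow> bool" where
  "var_free r D \<longleftrightarrow> (\<forall>m\<in>D. erase r m \<in> D)"

lemma upward_closedD: "upward_closed D \<Longrightarrow> m \<in> D \<Longrightarrow> m + w \<in> D"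
  by (simp add: upward_closed_def)

lemma upward_closedD': "upward_closed D \<Longrightarrow> m \<in> D \<Longrightarrow> w + m \<in> D"
  by (metis upward_closedD add.commute)

lemma sumsetI: "a \<in> D \<Longrightarrow> b \<in> E \<Longrightarrow> a + b \<in> sumset D E"
  by (auto simp: sumset_def)

lemma sumsetE:
  assumes "m \<in> sumset D E"
  obtains a b where "m = a + b" "a \<in> D" "b \<in> E"
  using assms by (auto simp: sumset_def)

lemma upward_closed_sumset: "upward_closed E \<Longrightarrow> upward_closed (sumset D E)"
  unfolding upward_closed_def
proof (intro impI ballI allI)
  fix m w assume E: "\<forall>m\<in>E. \<forall>w. m + w \<in> E" and "m \<in> sumset D E"
  then obtain a b where "m = a + b" "a \<in> D" "b \<in> E" by (auto elim: sumsetE)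
  with E sumsetI[of a D "b + w" E] show "m + w \<in> sumset D E" by (simp add: add.assoc)
qed

lemma upward_closed_sumpow: "upward_closed D \<Longrightarrow> upward_closed (sumpow D n)"
  by (cases n) (auto simp: upward_closed_sumset upward_closed_def[of UNIV])

lemma sumpow_mono: "D \<subseteq> E \<Longrightarrow> sumpow D n \<subseteq> sumpow E n"
proof (induction n)
  case (Suc n)
  then show ?case by (auto simp: sumset_def)
qed simp

lemma sumpow_add:
  assumes "upward_closed D" "a \<in> sumpow D i" "b \<in> sumpow D j"
  shows "a + b \<in> sumpow D (i + j)"
  using assms(3)
proof (induction j arbitrary: b)
  case 0
  \<comment> \<open>The zeroth power is everything, so \<open>b\<close> is arbitrary and has to be
    absorbed by upward closure.\<close>
  then show ?case using upward_closedD[OF upward_closed_sumpow[OF assms(1)] assms(2)] by simp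
next
  case (Suc j)
  then obtain c d where cd: "b = c + d" "c \<in> sumpow D j" "d \<in> D" by (auto elim: sumsetE)
  with Suc.IH[OF cd(2)] have "(a + c) + d \<in> sumpow D (i + Suc j)" by (auto intro: sumsetI)
  then show ?case by (simp add: cd(1) add.assoc)
qed

lemma lookup_erase: "Poly_Mapping.lookup (erase r m) i = (if i = r then 0 else Poly_Mapping.lookup m i)"
  by (auto simp: erase_def lookup_update)

lemma erase_add: "erase r (a + b) = erase r a + erase r b"
  by (rule poly_mapping_eqI) (simp add: lookup_erase lookup_add)

lemma erase_decomp: "m = erase r m + Poly_Mapping.single r (Poly_Mapping.lookup m r)"
  by (rule poly_mapping_eqI) (simp add: lookup_erase lookup_add lookup_single)

lemma erase_eq_self: "Poly_Mapping.lookup m r = 0 \<Longrightarrow> erase r m = m"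
  by (rule poly_mapping_eqI) (simp add: lookup_erase)

lemma erase_single_self: "erase r (Poly_Mapping.single r k) = 0"
  by (rule poly_mapping_eqI) (simp add: lookup_erase lookup_single)

lemma var_free_iff: "upward_closed D \<Longrightarrow> var_free r D \<Longrightarrow> erase r m \<in> D \<longleftrightarrow> m \<in> D"
  unfolding var_free_def by (metis erase_decomp upward_closedD)

lemma var_free_Int: "var_free r D \<Longrightarrow> var_free r E \<Longrightarrow> var_free r (D \<inter> E)"
  by (auto simp: var_free_def)

lemma upward_closed_Int: "upward_closed D \<Longrightarrow> upward_closed E \<Longrightarrow> upward_closed (D \<inter> E)"
  by (auto simp: upward_closed_def)

lemma var_free_sumset: "var_free r D \<Longrightarrow> var_free r E \<Longrightarrow> var_free r (sumset D E)"
  unfolding var_free_def by (metis (no_types, lifting) erase_add sumsetE sumsetI)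

lemma var_free_sumpow: "var_free r D \<Longrightarrow> var_free r (sumpow D n)"
  by (induction n) (simp_all add: var_free_sumset var_free_def[of r UNIV])

section \<open>Coefficients of products and divisibility of monomials\<close>

text \<open>The coefficient is a sum over all splittings of \<open>a + b\<close>, and only one of
  them can contribute. This excludes cancellation both when multiplying by a monomial and when
  multiplying leading terms.\<close>

lemma lookup_mult_unique:
  fixes f g :: "('n, 'k::field) mpoly"
  assumes "\<And>x y. x \<in> Poly_Mapping.keys f \<Longrightarrow> y \<in> Poly_Mapping.keys g \<Longrightarrow> x + y = a + b \<Longrightarrow> x = a \<and> y = b"
  shows "Poly_Mapping.lookup (f * g) (a + b) = Poly_Mapping.lookup f a * Poly_Mapping.lookup g b"
proof -
  let ?f = "Poly_Mapping.lookup f" and ?g = "Poly_Mapping.lookup g"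
  have "Poly_Mapping.lookup (f * g) (a + b) = (\<Sum>(x, y). ?f x * ?g y when a + b = x + y)"
    by (simp add: times_poly_mapping.rep_eq prod_fun_unfold_prod)
  also have "(\<lambda>(x, y). ?f x * ?g y when a + b = x + y) = (\<lambda>p. ?f a * ?g b when p = (a, b))"
  proof (rule ext, clarify)
    fix x y
    show "(?f x * ?g y when a + b = x + y) = (?f a * ?g b when (x, y) = (a, b))"
    proof (cases "x \<in> Poly_Mapping.keys f \<and> y \<in> Poly_Mapping.keys g")
      case True
      then show ?thesis using assms[of x y] by (auto simp: when_def)
    next
      case False
      then have "?f x * ?g y = 0" by (auto simp: in_keys_iff)
      then show ?thesis by (auto simp: when_def)
    qed
  qed
  also have "(\<Sum>p. ?f a * ?g b when p = (a, b)) = ?f a * ?g b"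
    by (simp add: Sum_any_when_equal)
  finally show ?thesis .
qed

lemma keys_mult_single:
  fixes f :: "('n, 'k::field) mpoly"
  shows "Poly_Mapping.keys (f * Poly_Mapping.single w 1) = (\<lambda>m. m + w) ` Poly_Mapping.keys f"
proof
  show "Poly_Mapping.keys (f * Poly_Mapping.single w 1) \<subseteq> (\<lambda>m. m + w) ` Poly_Mapping.keys f"
    using keys_mult[of f "Poly_Mapping.single w 1"] by auto
  show "(\<lambda>m. m + w) ` Poly_Mapping.keys f \<subseteq> Poly_Mapping.keys (f * Poly_Mapping.single w 1)"
    using lookup_mult_unique[of f "Poly_Mapping.single w 1" _ w]
    by (auto simp: in_keys_iff lookup_single when_def split: if_splits)
qed

lemma Var_dvd_single_iff:
  "(Var i :: ('n, 'k::field) mpoly) dvd Poly_Mapping.single u 1 \<longleftrightarrow> 0 < Poly_Mapping.lookup u i"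
proof
  assume "(Var i :: ('n, 'k) mpoly) dvd Poly_Mapping.single u 1"
  then obtain g :: "('n, 'k) mpoly" where "Poly_Mapping.single u 1 = g * Var i"
    by (metis dvdE mult.commute)
  then have "{u} = (\<lambda>m. m + Poly_Mapping.single i 1) ` Poly_Mapping.keys g"
    by (metis Var_def keys_mult_single keys_single zero_neq_one)
  then obtain m where "u = m + Poly_Mapping.single i 1" by blast
  then show "0 < Poly_Mapping.lookup u i" by (simp add: lookup_add)
next
  assume "0 < Poly_Mapping.lookup u i"
  then have "u = Poly_Mapping.single i 1 + (u - Poly_Mapping.single i 1)"
    by (intro poly_mapping_eqI) (auto simp: lookup_add lookup_minus lookup_single when_def)
  then have "Poly_Mapping.single u (1::'k) = Var i * Poly_Mapping.single (u - Poly_Mapping.single i 1) 1"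
    by (simp add: Var_def mult_single)
  then show "(Var i :: ('n, 'k) mpoly) dvd Poly_Mapping.single u 1" by (rule dvdI)
qed

section \<open>Monomial ideals as spans of exponent sets\<close>

lemma single_mem_mon_span: "Poly_Mapping.single m (1::'k::field) \<in> mon_span D \<longleftrightarrow> m \<in> D"
  by (simp add: mon_span_def)

lemma ideal_mon_span:
  assumes "upward_closed D"
  shows "ideal (mon_span D :: ('n, 'k::field) mpoly set) PolyRing"
proof (rule idealI)
  let ?T = "mon_span D :: ('n, 'k) mpoly set"
  have mult: "a * f \<in> ?T" if "f \<in> ?T" for a f
    using that keys_mult[of a f] upward_closedD'[OF assms] unfolding mon_span_def by blast
  show "ring (PolyRing :: ('n, 'k) mpoly ring)" by (rule ring_PolyRing)
  show "subgroup ?T (add_monoid PolyRing)"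
  proof (rule group.subgroupI)
    show "Group.group (add_monoid (PolyRing :: ('n, 'k) mpoly ring))"
      by (rule abelian_group.a_group[OF ring.is_abelian_group[OF ring_PolyRing]])
    show "?T \<noteq> {}" unfolding mon_span_def by (auto intro: exI[of _ 0])
    show "inv\<^bsub>add_monoid PolyRing\<^esub> a \<in> ?T" if "a \<in> ?T" for a
      using that uminus_class[of a] by (simp add: a_inv_def mon_span_def)
    show "a \<otimes>\<^bsub>add_monoid PolyRing\<^esub> b \<in> ?T" if "a \<in> ?T" "b \<in> ?T" for a b
      using that Poly_Mapping.keys_add[of a b] by (auto simp: mon_span_def cring_class_ops_def)
  qed (auto simp: cring_class_ops_def)
  show "x \<otimes>\<^bsub>PolyRing\<^esub> a \<in> ?T" if "a \<in> ?T" for a x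
    using mult[OF that] by (simp add: times_class)
  show "a \<otimes>\<^bsub>PolyRing\<^esub> x \<in> ?T" if "a \<in> ?T" for a x
    using mult[OF that, of x] by (simp add: times_class mult.commute)
qed

lemma ideal_add_closed:
  fixes a b :: "('n, 'k::field) mpoly"
  assumes "ideal J PolyRing" "a \<in> J" "b \<in> J"
  shows "a + b \<in> J"
  using additive_subgroup.a_closed[OF ideal.axioms(1)[OF assms(1)] assms(2,3)]
  by (simp add: plus_class)

lemma ideal_zero_closed:
  "ideal J (PolyRing :: ('n, 'k::field) mpoly ring) \<Longrightarrow> 0 \<in> J"
  using additive_subgroup.zero_closed[OF ideal.axioms(1)] by (fastforce simp: zero_class)

text \<open>Every polynomial is built up from 0 one term at a time. Inclusions of monomial ideals
  can therefore be checked on monomials alone.\<close>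

lemma mon_span_subset:
  fixes J :: "('n, 'k::field) mpoly set"
  assumes J: "ideal J PolyRing" and D: "\<And>m. m \<in> D \<Longrightarrow> Poly_Mapping.single m 1 \<in> J"
  shows "mon_span D \<subseteq> J"
proof
  fix f :: "('n, 'k) mpoly"
  assume "f \<in> mon_span D"
  then show "f \<in> J"
  proof (induction f rule: update_induct)
    case const
    show ?case by (rule ideal_zero_closed[OF J])
  next
    case (update f a b)
    have keys: "Poly_Mapping.keys (Poly_Mapping.update a b f) = insert a (Poly_Mapping.keys f)"
      using update(2) by (simp add: keys_update)
    \<comment> \<open>The new term is split into a constant times a monic monomial, since
      \<open>D\<close> speaks only of coefficient 1 and the ideal absorbs the constant.\<close>
    have eq: "Poly_Mapping.update a b f = f + Poly_Mapping.single 0 b * Poly_Mapping.single a 1"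
    proof (rule poly_mapping_eqI)
      fix k
      have "Poly_Mapping.lookup f a = 0" using update(1) by (simp add: in_keys_iff)
      then show "Poly_Mapping.lookup (Poly_Mapping.update a b f) k =
          Poly_Mapping.lookup (f + Poly_Mapping.single 0 b * Poly_Mapping.single a 1) k"
        by (simp add: mult_single lookup_update lookup_add lookup_single when_def) auto
    qed
    from update.prems keys have "f \<in> mon_span D" "a \<in> D" by (auto simp: mon_span_def)
    then show ?case unfolding eq
      by (intro ideal_add_closed[OF J] ideal_mult_left[OF J] update.IH D)
  qed
qed

text \<open>An ideal generated by monomials contains each monomial of each of its elements: the span
  of its monomials is itself an ideal and contains the generators.\<close>

lemma genideal_eq_mon_span:
  fixes M :: "('n, 'k::field) mpoly set"
  assumes M: "M \<subseteq> monomials"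
  defines "D \<equiv> {m. Poly_Mapping.single m 1 \<in> Idl\<^bsub>PolyRing\<^esub> M}"
  shows "Idl\<^bsub>PolyRing\<^esub> M = mon_span D" and "upward_closed D"
proof -
  show up: "upward_closed D"
    unfolding D_def single_in_genideal_iff[OF M] upward_closed_def by (auto simp: add.assoc)
  have "M \<subseteq> mon_span D"
  proof
    fix f assume f: "f \<in> M"
    with M obtain m where "f = Poly_Mapping.single m 1" by (auto simp: monomials_def)
    with f genideal_self_PolyRing[of M] show "f \<in> mon_span D"
      by (auto simp: mon_span_def D_def)
  qed
  then have "Idl\<^bsub>PolyRing\<^esub> M \<subseteq> mon_span D"
    by (intro genideal_minimal_PolyRing ideal_mon_span up)
  moreover have "mon_span D \<subseteq> Idl\<^bsub>PolyRing\<^esub> M"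
    by (rule mon_span_subset[OF genideal_is_ideal]) (simp add: D_def)
  ultimately show "Idl\<^bsub>PolyRing\<^esub> M = mon_span D" by blast
qed

lemma genideal_eqI:
  fixes M :: "('n, 'k::field) mpoly set"
  assumes "M \<subseteq> monomials" and "\<And>m. Poly_Mapping.single m 1 \<in> Idl\<^bsub>PolyRing\<^esub> M \<longleftrightarrow> m \<in> D"
  shows "Idl\<^bsub>PolyRing\<^esub> M = mon_span D"
  using genideal_eq_mon_span(1)[OF assms(1)] unfolding assms(2) Collect_mem_eq .

lemma monomial_idealE:
  fixes J :: "('n, 'k::field) mpoly set"
  assumes "monomial_ideal J"
  obtains D where "J = mon_span D" "upward_closed D"
  using assms genideal_eq_mon_span unfolding monomial_ideal_def by metis

lemma Var_image_monomials: "Var ` A \<subseteq> monomials"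
  by (auto simp: Var_def monomials_def)

lemma genideal_Var:
  "Idl\<^bsub>PolyRing\<^esub> (Var ` A :: ('n, 'k::field) mpoly set) = mon_span {m. \<exists>i\<in>A. 0 < Poly_Mapping.lookup m i}"
proof -
  have "Poly_Mapping.single m 1 \<in> Idl\<^bsub>PolyRing\<^esub> (Var ` A :: ('n, 'k) mpoly set) \<longleftrightarrow>
      (\<exists>i\<in>A. 0 < Poly_Mapping.lookup m i)" for m
  proof
    assume "Poly_Mapping.single m 1 \<in> Idl\<^bsub>PolyRing\<^esub> (Var ` A :: ('n, 'k) mpoly set)"
    then obtain u w where uw: "Poly_Mapping.single u (1::'k) \<in> Var ` A" "m = u + w"
      unfolding single_in_genideal_iff[OF Var_image_monomials] by blast
    then obtain i where i: "i \<in> A" "Poly_Mapping.single u (1::'k) = Var i" by blast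
    then have "Var i dvd Poly_Mapping.single u (1::'k)" by simp
    then show "\<exists>i\<in>A. 0 < Poly_Mapping.lookup m i"
      unfolding Var_dvd_single_iff using i(1) uw(2) by (auto simp: lookup_add)
  next
    assume "\<exists>i\<in>A. 0 < Poly_Mapping.lookup m i"
    then obtain i where i: "i \<in> A" "Var i dvd Poly_Mapping.single m (1::'k)"
      by (auto simp: Var_dvd_single_iff)
    then have "Var i \<in> Idl\<^bsub>PolyRing\<^esub> (Var ` A :: ('n, 'k) mpoly set)"
      using genideal_self_PolyRing[of "Var ` A"] by blast
    with i(2) show "Poly_Mapping.single m 1 \<in> Idl\<^bsub>PolyRing\<^esub> (Var ` A :: ('n, 'k) mpoly set)"
      by (metis dvdE ideal_mult_left genideal_is_ideal mult.commute)
  qed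
  then show ?thesis by (intro genideal_eqI[OF Var_image_monomials]) simp
qed

section \<open>Products, powers, intersections and sums on the level of exponents\<close>

lemma ideal_prod_mon_span:
  assumes "upward_closed D" "upward_closed E"
  shows "(mon_span D :: ('n, 'k::field) mpoly set) \<cdot>\<^bsub>PolyRing\<^esub> mon_span E = mon_span (sumset D E)"
proof
  show "(mon_span D :: ('n, 'k) mpoly set) \<cdot>\<^bsub>PolyRing\<^esub> mon_span E \<subseteq> mon_span (sumset D E)"
  proof
    fix f :: "('n, 'k) mpoly"
    assume "f \<in> mon_span D \<cdot>\<^bsub>PolyRing\<^esub> mon_span E"
    then show "f \<in> mon_span (sumset D E)"
    proof induction
      case (prod f g)
      then show ?case using keys_mult[of f g] by (fastforce simp: mon_span_def sumset_def times_class)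
    next
      case (sum f g)
      then show ?case
        unfolding plus_class
        by (intro ideal_add_closed[OF ideal_mon_span[OF upward_closed_sumset[OF assms(2)]]])
    qed
  qed
  show "mon_span (sumset D E) \<subseteq> (mon_span D :: ('n, 'k) mpoly set) \<cdot>\<^bsub>PolyRing\<^esub> mon_span E"
  proof (rule mon_span_subset)
    show "ideal ((mon_span D :: ('n, 'k) mpoly set) \<cdot>\<^bsub>PolyRing\<^esub> mon_span E) PolyRing"
      by (intro ring.ideal_prod_is_ideal ring_PolyRing ideal_mon_span assms)
    fix m assume "m \<in> sumset D E"
    then obtain a b where ab: "m = a + b" "a \<in> D" "b \<in> E" by (rule sumsetE)
    have "Poly_Mapping.single a (1::'k) \<otimes>\<^bsub>PolyRing\<^esub> Poly_Mapping.single b 1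
        \<in> mon_span D \<cdot>\<^bsub>PolyRing\<^esub> mon_span E"
      using ab by (intro ideal_prod.prod) (simp_all add: single_mem_mon_span)
    then show "Poly_Mapping.single m (1::'k) \<in> mon_span D \<cdot>\<^bsub>PolyRing\<^esub> mon_span E"
      by (simp add: ab(1) times_class mult_single)
  qed
qed

lemma ideal_power_mon_span:
  assumes "upward_closed D"
  shows "ideal_power (mon_span D :: ('n, 'k::field) mpoly set) n = mon_span (sumpow D n)"
proof (induction n)
  case 0
  show ?case by (simp add: ideals_set_def cring_class_ops_def mon_span_def)
next
  case (Suc n)
  then show ?case
    by (simp add: ideals_set_def ideal_prod_mon_span[OF upward_closed_sumpow[OF assms] assms])
qed

lemma mon_span_Int: "mon_span D \<inter> mon_span E = mon_span (D \<inter> E)"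
  by (auto simp: mon_span_def)

text \<open>Every monomial of a multiple of x_r is divisible by x_r, so passing from q to (q, x_r)
  adjoins just these monomials.\<close>

lemma add_PIdl_Var_mon_span:
  assumes D: "upward_closed D"
  shows "(mon_span D :: ('n, 'k::field) mpoly set) <+>\<^bsub>PolyRing\<^esub> PIdl\<^bsub>PolyRing\<^esub> (Var r) =
    mon_span (D \<union> {m. 0 < Poly_Mapping.lookup m r})" (is "?S = mon_span ?E")
proof
  have mem: "f \<in> ?S \<longleftrightarrow> (\<exists>g\<in>mon_span D. \<exists>h. f = g + h * Var r)" for f :: "('n, 'k) mpoly"
    by (auto simp: set_add_def' cgenideal_def times_class plus_class carrier_PolyRing)
  show "?S \<subseteq> mon_span ?E"
  proof
    fix f assume "f \<in> ?S"
    then obtain g h where g: "g \<in> mon_span D" and f: "f = g + h * Var r" unfolding mem by blast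
    have "Poly_Mapping.keys (h * Var r) \<subseteq> {m. 0 < Poly_Mapping.lookup m r}"
      unfolding Var_def keys_mult_single by (auto simp: lookup_add)
    with g Poly_Mapping.keys_add[of g "h * Var r"] show "f \<in> mon_span ?E"
      unfolding f mon_span_def by blast
  qed
  show "mon_span ?E \<subseteq> ?S"
  proof (rule mon_span_subset)
    show "ideal ?S PolyRing"
      by (intro ring.add_ideals[OF ring_PolyRing] ideal_mon_span[OF D]
          cring.cgenideal_ideal[OF cring_class]) (simp add: carrier_PolyRing)
    fix m assume "m \<in> ?E"
    then consider "m \<in> D" | "Var r dvd Poly_Mapping.single m (1::'k)"
      by (auto simp: Var_dvd_single_iff)
    then show "Poly_Mapping.single m 1 \<in> ?S"
    proof cases
      case 1
      then show ?thesis unfolding mem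
        by (intro bexI[of _ "Poly_Mapping.single m 1"] exI[of _ 0]) (simp_all add: single_mem_mon_span)
    next
      case 2
      then obtain h where "Poly_Mapping.single m (1::'k) = Var r * h" by (rule dvdE)
      then show ?thesis unfolding mem
        by (intro bexI[of _ 0] exI[of _ h]) (simp_all add: mon_span_def mult.commute)
    qed
  qed
qed

section \<open>Minimal generators, support and deletion\<close>

lemma mingens_monomial_ideal:
  fixes J :: "('n::finite, 'k::field) mpoly set"
  assumes "monomial_ideal J"
  shows "mingens J \<subseteq> monomials" "Idl\<^bsub>PolyRing\<^esub> (mingens J) = J"
proof -
  have "min_monomial_gens J (mingens J)"
    unfolding mingens_def by (rule theI'[OF min_monomial_gens_ex1[OF assms]])
  then show "mingens J \<subseteq> monomials" "Idl\<^bsub>PolyRing\<^esub> (mingens J) = J"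
    unfolding min_monomial_gens_def by (blast, blast)
qed

lemma mon_span_mem_iff_mingens:
  fixes D :: "('n::finite \<Rightarrow>\<^sub>0 nat) set"
  assumes "monomial_ideal (mon_span D :: ('n, 'k::field) mpoly set)"
  shows "m \<in> D \<longleftrightarrow> (\<exists>u w. Poly_Mapping.single u (1::'k) \<in> mingens (mon_span D) \<and> m = u + w)"
  using single_in_genideal_iff[OF mingens_monomial_ideal(1)[OF assms], of m]
  by (simp add: mingens_monomial_ideal(2)[OF assms] single_mem_mon_span)

text \<open>A minimal generator dividing \<open>m\<close> does not involve x_r, so it still divides
  \<open>m\<close> once x_r is erased.\<close>

lemma var_free_if_notin_supp:
  fixes D :: "('n::finite \<Rightarrow>\<^sub>0 nat) set"
  assumes J: "monomial_ideal (mon_span D :: ('n, 'k::field) mpoly set)"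
    and r: "Var r \<notin> supp (mon_span D :: ('n, 'k) mpoly set)"
  shows "var_free r D"
  unfolding var_free_def
proof
  fix m assume "m \<in> D"
  then obtain u w where uw: "Poly_Mapping.single u (1::'k) \<in> mingens (mon_span D)" "m = u + w"
    unfolding mon_span_mem_iff_mingens[OF J] by blast
  with r have "\<not> Var r dvd Poly_Mapping.single u (1::'k)" unfolding supp_def by blast
  then have "erase r u = u" by (simp add: Var_dvd_single_iff erase_eq_self)
  with uw show "erase r m \<in> D"
    unfolding mon_span_mem_iff_mingens[OF J] by (metis erase_add)
qed

text \<open>Putting x_r = 0 discards the generators divisible by x_r. The remaining ones divide
  \<open>m\<close> iff they divide \<open>erase r m\<close>, and a discarded one never divides
  \<open>erase r m\<close>.\<close>

lemma deletion_mon_span: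
  fixes D :: "('n::finite \<Rightarrow>\<^sub>0 nat) set"
  assumes J: "monomial_ideal (mon_span D :: ('n, 'k::field) mpoly set)"
  shows "deletion r (mon_span D :: ('n, 'k) mpoly set) = mon_span {m. erase r m \<in> D}"
proof -
  let ?G = "mingens (mon_span D :: ('n, 'k) mpoly set)"
  let ?G' = "{u \<in> ?G. \<not> Var r dvd u}"
  let ?H = "(\<lambda>u. if Var r dvd u then 0 else u) ` ?G"
  have G': "?G' \<subseteq> monomials" using mingens_monomial_ideal(1)[OF J] by blast
  have "?H \<subseteq> Idl\<^bsub>PolyRing\<^esub> ?G'"
    using genideal_self_PolyRing[of ?G'] ideal_zero_closed[OF genideal_is_ideal[of ?G']] by auto
  moreover have "?G' \<subseteq> ?H" by force
  then have "?G' \<subseteq> Idl\<^bsub>PolyRing\<^esub> ?H" using genideal_self_PolyRing[of ?H] by blast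
  ultimately have "deletion r (mon_span D) = Idl\<^bsub>PolyRing\<^esub> ?G'"
    unfolding deletion_def by (intro subset_antisym genideal_minimal_PolyRing genideal_is_ideal)
  moreover have "Poly_Mapping.single m 1 \<in> Idl\<^bsub>PolyRing\<^esub> ?G' \<longleftrightarrow> erase r m \<in> D" for m
  proof
    assume "Poly_Mapping.single m 1 \<in> Idl\<^bsub>PolyRing\<^esub> ?G'"
    then obtain u w where u: "Poly_Mapping.single u 1 \<in> ?G'" "m = u + w"
      unfolding single_in_genideal_iff[OF G'] by blast
    then have "erase r m = u + erase r w"
      by (simp add: Var_dvd_single_iff erase_eq_self erase_add)
    with u(1) show "erase r m \<in> D" unfolding mon_span_mem_iff_mingens[OF J] by blast
  next
    assume "erase r m \<in> D"
    then obtain u w where u: "Poly_Mapping.single u 1 \<in> ?G" "erase r m = u + w"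
      unfolding mon_span_mem_iff_mingens[OF J] by blast
    have "Poly_Mapping.lookup (erase r m) r = 0" by (simp add: lookup_erase)
    then have "Poly_Mapping.lookup u r = 0" by (simp add: u(2) lookup_add)
    then have "Poly_Mapping.single u 1 \<in> ?G'" using u(1) by (simp add: Var_dvd_single_iff)
    moreover have "m = u + (w + Poly_Mapping.single r (Poly_Mapping.lookup m r))"
      using erase_decomp[of m r] u(2) by (simp add: add.assoc)
    ultimately show "Poly_Mapping.single m 1 \<in> Idl\<^bsub>PolyRing\<^esub> ?G'"
      unfolding single_in_genideal_iff[OF G'] by blast
  qed
  ultimately show ?thesis using genideal_eqI[OF G', of "{m. erase r m \<in> D}"] by simp
qed

section \<open>Ideals generated by variables are prime\<close>

text \<open>Numbering the finitely many variables embeds the exponents additively into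
  \<open>nat \<Rightarrow>\<^sub>0 nat\<close>, which is linearly ordered compatibly with addition.
  Pulling this order back along \<open>E\<close> gives a monomial order.\<close>

lemma exponents_embed_linorder:
  obtains E :: "('n::finite \<Rightarrow>\<^sub>0 nat) \<Rightarrow> (nat \<Rightarrow>\<^sub>0 nat)"
  where "inj E" "\<And>a b. E (a + b) = E a + E b"
proof -
  obtain e :: "'n \<Rightarrow> nat" where e: "inj e" using finite_imp_inj_to_nat_seg[of "UNIV :: 'n set"] by auto
  define E :: "('n \<Rightarrow>\<^sub>0 nat) \<Rightarrow> (nat \<Rightarrow>\<^sub>0 nat)" where
    "E m = (\<Sum>i\<in>UNIV. Poly_Mapping.single (e i) (Poly_Mapping.lookup m i))" for m
  have "Poly_Mapping.lookup (E m) (e j) = Poly_Mapping.lookup m j" for m j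
    by (simp add: E_def lookup_sum lookup_single when_def inj_eq[OF e])
  then have "inj E" by (intro injI poly_mapping_eqI) metis
  moreover have "E (a + b) = E a + E b" for a b
    by (simp add: E_def lookup_add single_add sum.distrib)
  ultimately show thesis by (rule that)
qed

text \<open>
  Among the monomials avoiding \<open>B\<close> of two polynomials outside the ideal, the product of the two
  leading ones cannot cancel.
\<close>

lemma primeideal_genideal_Var:
  "primeideal (Idl\<^bsub>PolyRing\<^esub> (Var ` B)) (PolyRing :: ('n::finite, 'k::field) mpoly ring)"
proof -
  define U where "U = {m :: 'n \<Rightarrow>\<^sub>0 nat. \<exists>i\<in>B. 0 < Poly_Mapping.lookup m i}"
  have U_add: "a + b \<in> U \<longleftrightarrow> a \<in> U \<or> b \<in> U" for a b by (auto simp: U_def lookup_add)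
  obtain E :: "('n \<Rightarrow>\<^sub>0 nat) \<Rightarrow> (nat \<Rightarrow>\<^sub>0 nat)"
    where E: "inj E" "\<And>a b. E (a + b) = E a + E b" by (rule exponents_embed_linorder) blast
  have lead: "\<exists>a. a \<in> Poly_Mapping.keys f - U \<and> (\<forall>x\<in>Poly_Mapping.keys f - U. E x \<le> E a)"
    if "f \<notin> mon_span U" for f :: "('n, 'k) mpoly"
  proof -
    let ?S = "Poly_Mapping.keys f - U"
    have "?S \<noteq> {}" "finite ?S" using that by (auto simp: mon_span_def)
    then have "Max (E ` ?S) \<in> E ` ?S" "\<forall>x\<in>?S. E x \<le> Max (E ` ?S)" by simp_all
    then obtain a where "a \<in> ?S" "\<forall>x\<in>?S. E x \<le> E a" by (metis imageE)
    then show ?thesis by blast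
  qed
  have "f \<in> mon_span U \<or> g \<in> mon_span U" if "f * g \<in> mon_span U" for f g :: "('n, 'k) mpoly"
  proof (rule ccontr)
    assume "\<not> ?thesis"
    then obtain a b where
      a: "a \<in> Poly_Mapping.keys f - U" "\<And>x. x \<in> Poly_Mapping.keys f - U \<Longrightarrow> E x \<le> E a" and
      b: "b \<in> Poly_Mapping.keys g - U" "\<And>x. x \<in> Poly_Mapping.keys g - U \<Longrightarrow> E x \<le> E b"
      using lead by metis
    have "x = a \<and> y = b"
      if x: "x \<in> Poly_Mapping.keys f" and y: "y \<in> Poly_Mapping.keys g" and eq: "x + y = a + b" for x y
    proof -
      \<comment> \<open>The sum avoids \<open>U\<close>, hence so do both summands, and maximality
        of \<open>a\<close> and \<open>b\<close> applies to them.\<close>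
      have "x + y \<notin> U" using a(1) b(1) by (simp add: eq U_add)
      then have le: "E x \<le> E a" "E y \<le> E b" using a(2) b(2) x y by (simp_all add: U_add)
      have "E x + E y = E a + E b" by (metis E(2) eq)
      with le have "E x = E a"
        by (metis add_less_le_mono order_le_less order_less_irrefl)
      then have "x = a" using E(1) by (simp add: inj_eq)
      with eq show ?thesis by simp
    qed
    then have "Poly_Mapping.lookup (f * g) (a + b) = Poly_Mapping.lookup f a * Poly_Mapping.lookup g b"
      by (rule lookup_mult_unique)
    then have "a + b \<in> Poly_Mapping.keys (f * g)" using a(1) b(1) by (simp add: in_keys_iff)
    with that have "a + b \<in> U" by (auto simp: mon_span_def)
    with a(1) b(1) show False by (simp add: U_add)
  qed
  moreover have "Poly_Mapping.single 0 (1::'k) \<notin> mon_span U"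
    unfolding single_mem_mon_span by (simp add: U_def)
  moreover have "upward_closed U" by (simp add: upward_closed_def U_add)
  ultimately have "primeideal (mon_span U) (PolyRing :: ('n, 'k) mpoly ring)"
    by (intro primeidealI ideal_mon_span cring_class)
      (auto simp: carrier_PolyRing times_class)
  then show ?thesis by (simp add: genideal_Var U_def)
qed

section \<open>The layers of L^s by degree in x_r\<close>

text \<open>One factor from Q is reread as a factor from the larger ideal.\<close>

lemma sumset_sumpow_Suc_subset:
  assumes "Q \<subseteq> D" "upward_closed Q"
  shows "sumset (sumpow D j) (sumpow Q (Suc k)) \<subseteq> sumset (sumpow D (Suc j)) (sumpow Q k)"
proof
  fix m assume "m \<in> sumset (sumpow D j) (sumpow Q (Suc k))"
  then obtain a b c where abc: "m = a + (b + c)" "a \<in> sumpow D j" "b \<in> sumpow Q k" "c \<in> Q"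
    by (auto elim!: sumsetE)
  then have "(a + c) + b \<in> sumset (sumpow D (Suc j)) (sumpow Q k)"
    using assms(1) by (auto intro!: sumsetI)
  then show "m \<in> sumset (sumpow D (Suc j)) (sumpow Q k)" by (simp add: abc(1) ac_simps)
qed

lemma sumset_sumpow_mono:
  assumes "Q \<subseteq> D" "upward_closed Q" "j \<le> \<theta>" "\<theta> \<le> s"
  shows "sumset (sumpow D j) (sumpow Q (s - j)) \<subseteq> sumset (sumpow D \<theta>) (sumpow Q (s - \<theta>))"
  using assms(3,4)
proof (induction \<theta> rule: dec_induct)
  case (step n)
  then have "s - n = Suc (s - Suc n)" by simp
  with sumset_sumpow_Suc_subset[OF assms(1,2), of n "s - Suc n"] step show ?case by auto
qed simp

text \<open>
  With \<open>L = Q + x\<^sub>r I\<close> and \<open>Q = I \<inter> q \<subseteq> I\<close>, the part of \<open>L\<^sup>s = \<Sum>\<^sub>j x\<^sub>r\<^sup>j I\<^sup>j Q\<^bsup>s-j\<^esup>\<close> of degree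
  \<open>\<theta>\<close> in \<open>x\<^sub>r\<close> is the union of the increasing family \<open>I\<^sup>j Q\<^bsup>s-j\<^esup>\<close>, \<open>j \<le> \<theta>\<close>.
\<close>

lemma sumpow_slice_iff:
  assumes D: "upward_closed D" "var_free r D" and Q: "upward_closed Q" "var_free r Q" and "Q \<subseteq> D"
    and "Poly_Mapping.lookup m r \<le> s"
  defines "\<theta> \<equiv> Poly_Mapping.lookup m r"
  defines "L \<equiv> Q \<union> {m \<in> D. 0 < Poly_Mapping.lookup m r}"
  shows "m \<in> sumpow L s \<longleftrightarrow> m \<in> sumset (sumpow D \<theta>) (sumpow Q (s - \<theta>))" (is "_ \<longleftrightarrow> m \<in> ?S")
proof
  \<comment> \<open>Here \<open>j\<close> counts the factors from \<open>L\<close> that are not in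
    \<open>Q\<close>. Each of them is divisible by x_r, so \<open>j\<close> is at most the
    x_r-degree of the product.\<close>
  have "\<exists>j\<le>s. j \<le> Poly_Mapping.lookup m r \<and> m \<in> sumset (sumpow D j) (sumpow Q (s - j))"
    if "m \<in> sumpow L s" for m s
    using that
  proof (induction s arbitrary: m)
    case 0
    then show ?case using sumsetI[of m UNIV 0 UNIV] by auto
  next
    case (Suc s)
    then obtain a b where ab: "m = a + b" "a \<in> sumpow L s" "b \<in> L" by (auto elim: sumsetE)
    from Suc.IH[OF ab(2)] obtain j c d where
      j: "j \<le> s" "j \<le> Poly_Mapping.lookup a r" and
      cd: "a = c + d" "c \<in> sumpow D j" "d \<in> sumpow Q (s - j)" by (auto elim!: sumsetE)
    show ?case
    proof (cases "b \<in> Q")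
      case True
      with cd j have "d + b \<in> sumpow Q (Suc s - j)" by (simp add: Suc_diff_le sumsetI)
      with cd(2) have "c + (d + b) \<in> sumset (sumpow D j) (sumpow Q (Suc s - j))" by (rule sumsetI)
      with j show ?thesis by (intro exI[of _ j]) (simp add: ab cd add.assoc lookup_add)
    next
      case False
      with ab(3) have b: "b \<in> D" "0 < Poly_Mapping.lookup b r" by (auto simp: L_def)
      with cd have "c + b \<in> sumpow D (Suc j)" by (simp add: sumsetI)
      with cd(3) have "(c + b) + d \<in> sumset (sumpow D (Suc j)) (sumpow Q (Suc s - Suc j))"
        by (auto intro: sumsetI)
      with j b show ?thesis
        by (intro exI[of _ "Suc j"]) (auto simp: ab(1) cd(1) ac_simps lookup_add)
    qed
  qed
  moreover assume "m \<in> sumpow L s"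
  ultimately show "m \<in> ?S"
    using sumset_sumpow_mono[OF \<open>Q \<subseteq> D\<close> Q(1) _ assms(6)] unfolding \<theta>_def by blast
next
  have L: "upward_closed L"
    unfolding L_def upward_closed_def using upward_closedD[OF D(1)] upward_closedD[OF Q(1)]
    by (auto simp: lookup_add)
  \<comment> \<open>x_r^n I^n lies in L^n: each of the n factors from I receives one copy of
    x_r.\<close>
  have shift: "a + Poly_Mapping.single r n \<in> sumpow L n" if "a \<in> sumpow D n" for a n
    using that
  proof (induction n arbitrary: a)
    case (Suc n)
    then obtain b c where bc: "a = b + c" "b \<in> sumpow D n" "c \<in> D" by (auto elim: sumsetE)
    have "c + Poly_Mapping.single r 1 \<in> L"
      using upward_closedD[OF D(1) bc(3)] by (simp add: L_def lookup_add)
    with Suc.IH[OF bc(2)]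
    have "(b + Poly_Mapping.single r n) + (c + Poly_Mapping.single r 1) \<in> sumpow L (Suc n)"
      by (auto intro: sumsetI)
    moreover have "Poly_Mapping.single r (Suc n) = Poly_Mapping.single r n + Poly_Mapping.single r (1::nat)"
      by (simp flip: single_add)
    ultimately show ?case by (simp add: bc(1) ac_simps)
  qed simp
  assume "m \<in> ?S"
  moreover have "var_free r ?S" by (intro var_free_sumset var_free_sumpow assms)
  \<comment> \<open>The factors of \<open>m\<close> may already use up its copies of x_r. Factoring
    \<open>erase r m\<close> instead leaves all \<theta> copies free for the \<theta> factors from
    \<open>D\<close>.\<close>
  ultimately have "erase r m \<in> ?S" by (simp add: var_free_def)
  then obtain a b where ab: "erase r m = a + b" "a \<in> sumpow D \<theta>" "b \<in> sumpow Q (s - \<theta>)"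
    by (rule sumsetE)
  have "b \<in> sumpow L (s - \<theta>)" using ab(3) sumpow_mono[of Q L] by (auto simp: L_def)
  from sumpow_add[OF L shift[OF ab(2)] this]
  have "(a + Poly_Mapping.single r \<theta>) + b \<in> sumpow L s"
    using assms(6) by (simp add: \<theta>_def)
  also have "(a + Poly_Mapping.single r \<theta>) + b = m"
    using erase_decomp[of m r] ab(1) by (simp add: \<theta>_def ac_simps)
  finally show "m \<in> sumpow L s" .
qed

section \<open>Colon ideals and the conclusion\<close>

lemma Var_power: "(Var r :: ('n, 'k::field) mpoly) ^ n = Poly_Mapping.single (Poly_Mapping.single r n) 1"
  by (induction n) (simp_all add: Var_def mult_single flip: single_add)

text \<open>Multiplying by a monomial translates the support without cancellation, so the colon is
  computed exponent by exponent.\<close>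

lemma colon_mon_span:
  "colon (mon_span D) (Poly_Mapping.single w (1::'k::field)) = mon_span {m. m + w \<in> D}"
  by (auto simp: colon_def mon_span_def keys_mult_single)

theorem lemma3p2:
  fixes I q L p :: "('n::finite, 'k::field) mpoly set"
    and v :: "('n, 'k) mpoly" and r :: 'n and s \<theta> :: nat
  assumes "squarefree_monomial_ideal I"
    and "monomial_prime_ideal q"
    and "L = I \<inter> (q <+>\<^bsub>PolyRing\<^esub> PIdl\<^bsub>PolyRing\<^esub> (Var r))"
    and "Var r \<notin> supp q \<union> supp I"
    and "Ass L = Ass I \<union> {q <+>\<^bsub>PolyRing\<^esub> PIdl\<^bsub>PolyRing\<^esub> (Var r)}"
    and "monomial_prime_ideal p"
    and "s \<ge> 2" and "\<theta> \<le> s"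
    and "v \<in> monomials" and "\<not> Var r dvd v"
    and "p = colon (ideal_power L s) (Var r ^ \<theta> * v)"
  shows "deletion r p \<in> Ass (ideal_power I \<theta> \<cdot>\<^bsub>PolyRing\<^esub> ideal_power (I \<inter> q) (s - \<theta>))"
proof -
  have "monomial_ideal I"
    using assms(1) by (auto simp: squarefree_monomial_ideal_def monomial_ideal_def)
  moreover from this obtain D where I: "I = mon_span D" and D: "upward_closed D"
    by (rule monomial_idealE)
  ultimately have Dr: "var_free r D" using assms(4) by (auto intro: var_free_if_notin_supp)
  have mono: "monomial_ideal J" if "monomial_prime_ideal J" for J :: "('n, 'k) mpoly set"
    using that Var_image_monomials unfolding monomial_prime_ideal_def monomial_ideal_def by blast
  from mono[OF assms(2)] obtain F where q: "q = mon_span F" and F: "upward_closed F"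
    by (rule monomial_idealE)
  with mono[OF assms(2)] have Fr: "var_free r F" using assms(4) by (auto intro: var_free_if_notin_supp)
  define Q where "Q = D \<inter> F"
  have Iq: "I \<inter> q = mon_span Q" by (simp add: I q Q_def mon_span_Int)
  have Q: "upward_closed Q" "var_free r Q" "Q \<subseteq> D"
    using D F Dr Fr by (auto simp: Q_def upward_closed_Int var_free_Int)
  \<comment> \<open>The exponents of L = Q + x_r I: the second set describes the intersection of I
    with (x_r), which is x_r I because \<open>D\<close> is \<open>var_free\<close>.\<close>
  define E where "E = Q \<union> {m \<in> D. 0 < Poly_Mapping.lookup m r}"
  have L: "L = mon_span E"
    unfolding assms(3) q add_PIdl_Var_mon_span[OF F] I mon_span_Int
    by (rule arg_cong[of _ _ mon_span]) (auto simp: E_def Q_def)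
  have E: "upward_closed E"
    unfolding E_def upward_closed_def using upward_closedD[OF D] upward_closedD[OF Q(1)]
    by (auto simp: lookup_add)
  define S where "S = sumset (sumpow D \<theta>) (sumpow Q (s - \<theta>))"
  have S: "upward_closed S" "var_free r S"
    unfolding S_def using D Dr Q
    by (auto intro: upward_closed_sumset upward_closed_sumpow var_free_sumset var_free_sumpow)
  have prod: "ideal_power I \<theta> \<cdot>\<^bsub>PolyRing\<^esub> ideal_power (I \<inter> q) (s - \<theta>) = mon_span S"
    unfolding Iq unfolding I
    by (simp add: S_def ideal_power_mon_span ideal_prod_mon_span upward_closed_sumpow D Q)
  obtain w where v: "v = Poly_Mapping.single w 1" using assms(9) by (auto simp: monomials_def)
  have wr: "Poly_Mapping.lookup w r = 0" using assms(10) by (simp add: v Var_dvd_single_iff)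
  define P where "P = {m. m + (Poly_Mapping.single r \<theta> + w) \<in> sumpow E s}"
  have p: "p = mon_span P"
    unfolding assms(11) L ideal_power_mon_span[OF E] v Var_power mult_single
    by (simp add: colon_mon_span P_def)
  \<comment> \<open>Neither \<open>erase r m\<close> nor \<open>w\<close> involves x_r, so the
    exponent tested against L^s has x_r-degree exactly \<theta>, and \<open>sumpow_slice_iff\<close>
    turns it into a test against \<open>S\<close>.\<close>
  have "erase r m \<in> P \<longleftrightarrow> m + w \<in> S" for m
  proof -
    let ?m = "erase r m + (Poly_Mapping.single r \<theta> + w)"
    have r: "Poly_Mapping.lookup ?m r = \<theta>" by (simp add: lookup_add lookup_erase wr)
    have "erase r ?m = erase r (m + w)"
      by (simp add: erase_add erase_single_self) (simp add: erase_eq_self lookup_erase)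
    then have "?m \<in> S \<longleftrightarrow> m + w \<in> S" by (metis var_free_iff[OF S])
    moreover have "?m \<in> sumpow E s \<longleftrightarrow> ?m \<in> S"
      using sumpow_slice_iff[OF D Dr Q, of ?m s] assms(8) unfolding r E_def S_def by simp
    ultimately show ?thesis by (simp add: P_def)
  qed
  then have del: "deletion r p = colon (mon_span S) v"
    using deletion_mon_span[of P, where 'k = 'k] mono[OF assms(6)] by (simp add: p v colon_mon_span)
  obtain A where A: "p = Idl\<^bsub>PolyRing\<^esub> (Var ` A)"
    using assms(6) by (auto simp: monomial_prime_ideal_def)
  have "deletion r p = mon_span {m. erase r m \<in> {m. \<exists>i\<in>A. 0 < Poly_Mapping.lookup m i}}"
    using mono[OF assms(6)] unfolding A genideal_Var by (rule deletion_mon_span)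
  \<comment> \<open>The deletion is again generated by variables, namely those of p other than x_r;
    if none remain, it is the zero ideal, which is prime as well.\<close>
  also have "\<dots> = Idl\<^bsub>PolyRing\<^esub> (Var ` (A - {r}))"
    unfolding genideal_Var by (rule arg_cong[of _ _ mon_span]) (auto simp: lookup_erase)
  finally have "primeideal (deletion r p) PolyRing" by (simp add: primeideal_genideal_Var)
  \<comment> \<open>The element witnessing the associated prime is \<open>v\<close>.\<close>
  with del show ?thesis unfolding Ass_def prod by blast
qed

end
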